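(* Let $\underline{\alpha}=1+2\mathbf{i}+4\mathbf{j}+8\mathbf{k}$, and for integers $r\ge 0$ let $UN_{r+1}^{(3)}=\frac{1}{7}\left(2VN_{r}^{(3)}-VN_{r+1}^{(3)}\right)$. Then for all integers $n\ge m\ge 0$, $$JN_{n}^{(3)}JN_{m+1}^{(3)}-JN_{n+1}^{(3)}JN_{m}^{(3)}=\frac{1}{7}\Big(\underline{\alpha}\left(2^{n+1}UN_{m+1}^{(3)}-2^{m+1}UN_{n+1}^{(3)}\right)+(1-\mathbf{i}-\mathbf{j}+2\mathbf{k})\,U_{n-m}^{(3)}\Big),$$ and for all integers $m\ge 0$, $$\left(JN_{m+1}^{(3)}\right)^{2}-JN_{m+2}^{(3)}JN_{m}^{(3)}=\frac{1}{7}\Big(2^{m+1}\underline{\alpha}\left(2UN_{m+1}^{(3)}-UN_{m+2}^{(3)}\right)+(1-\mathbf{i}-\mathbf{j}+2\mathbf{k})\Big).$$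
   Context: Dual quaternions: the real algebra of elements $a+b\mathbf{i}+c\mathbf{j}+d\mathbf{k}$ ($a,b,c,d\in\mathbb{R}$) with componentwise addition and bilinear multiplication determined by $1$ being the identity and $\mathbf{i}^2=\mathbf{j}^2=\mathbf{k}^2=0$, $\mathbf{ij}=\mathbf{ji}=\mathbf{jk}=\mathbf{kj}=\mathbf{ik}=\mathbf{ki}=0$ (all products of two units among $\mathbf{i},\mathbf{j},\mathbf{k}$ vanish). The third-order Jacobsthal numbers are defined by $J_0^{(3)}=0$, $J_1^{(3)}=J_2^{(3)}=1$, $J_{n+3}^{(3)}=J_{n+2}^{(3)}+J_{n+1}^{(3)}+2J_n^{(3)}$ for $n\ge 0$. The superscript $(3)$ is part of the notation, not an exponent. The dual third-order Jacobsthal quaternions are $JN_m^{(3)}=J_m^{(3)}+J_{m+1}^{(3)}\mathbf{i}+J_{m+2}^{(3)}\mathbf{j}+J_{m+3}^{(3)}\mathbf{k}$ for $m\ge 0$. The sequence $V_n^{(3)}$ ($n\ge 0$) is given by $V_n^{(3)}=2$ if $n\equiv 0 \pmod 3$, $V_n^{(3)}=-3$ if $n\equiv 1\pmod 3$, $V_n^{(3)}=1$ if $n\equiv 2\pmod 3$, and $VN_{m}^{(3)}=V_{m}^{(3)}+V_{m+1}^{(3)}\mathbf{i}+V_{m+2}^{(3)}\mathbf{j}+V_{m+3}^{(3)}\mathbf{k}$. The scalar sequence $U_m^{(3)}$ ($m\ge 0$) is $U_{m}^{(3)}=\frac{1}{7}\left(V_{m+1}^{(3)}+3V_{m+2}^{(3)}\right)$.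 *)

theory Defs
  imports Complex_Main
begin

text \<open>
  Dual quaternions as quadruples of reals: \<open>DQuat a b c d\<close> stands for \<open>a + b i + c j + d k\<close>
  (see \<open>DQuat_eq\<close>).
  The three units commute and all products of two of them vanish (see \<open>dq_unit_mult\<close>).
\<close>

datatype dquat = DQuat (dq_re: real) (dq_im1: real) (dq_im2: real) (dq_im3: real)

lemma dquat_eq_iff:
  "x = y \<longleftrightarrow> dq_re x = dq_re y \<and> dq_im1 x = dq_im1 y \<and> dq_im2 x = dq_im2 y \<and> dq_im3 x = dq_im3 y"
  by (cases x; cases y) simp

instantiation dquat :: "{comm_ring_1, real_algebra_1}"
begin

definition "0 = DQuat 0 0 0 0"

definition "1 = DQuat 1 0 0 0"

definition "x + y = DQuat (dq_re x + dq_re y) (dq_im1 x + dq_im1 y)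
  (dq_im2 x + dq_im2 y) (dq_im3 x + dq_im3 y)"

definition "- x = DQuat (- dq_re x) (- dq_im1 x) (- dq_im2 x) (- dq_im3 x)"

definition "x - y = DQuat (dq_re x - dq_re y) (dq_im1 x - dq_im1 y)
  (dq_im2 x - dq_im2 y) (dq_im3 x - dq_im3 y)"

definition "r *\<^sub>R x = DQuat (r * dq_re x) (r * dq_im1 x) (r * dq_im2 x) (r * dq_im3 x)"

definition "x * y = DQuat (dq_re x * dq_re y)
  (dq_re x * dq_im1 y + dq_im1 x * dq_re y)
  (dq_re x * dq_im2 y + dq_im2 x * dq_re y)
  (dq_re x * dq_im3 y + dq_im3 x * dq_re y)"

instance
  by standard
    (simp_all add: dquat_eq_iff zero_dquat_def one_dquat_def plus_dquat_def uminus_dquat_def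
      minus_dquat_def scaleR_dquat_def times_dquat_def algebra_simps)

end

definition dq_i :: dquat where "dq_i = DQuat 0 1 0 0"
definition dq_j :: dquat where "dq_j = DQuat 0 0 1 0"
definition dq_k :: dquat where "dq_k = DQuat 0 0 0 1"

lemma DQuat_eq:
  "DQuat a b c d = a *\<^sub>R 1 + b *\<^sub>R dq_i + c *\<^sub>R dq_j + d *\<^sub>R dq_k"
  by (simp add: dq_i_def dq_j_def dq_k_def one_dquat_def plus_dquat_def scaleR_dquat_def)

lemma dq_unit_mult:
  assumes "x \<in> {dq_i, dq_j, dq_k}" "y \<in> {dq_i, dq_j, dq_k}"
  shows "x * y = 0"
  using assms
  by (auto simp: dq_i_def dq_j_def dq_k_def times_dquat_def zero_dquat_def)

fun jacobsthal3 :: "nat \<Rightarrow> nat" where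
  "jacobsthal3 0 = 0"
| "jacobsthal3 (Suc 0) = 1"
| "jacobsthal3 (Suc (Suc 0)) = 1"
| "jacobsthal3 (Suc (Suc (Suc n))) =
     jacobsthal3 (Suc (Suc n)) + jacobsthal3 (Suc n) + 2 * jacobsthal3 n"

definition JN3 :: "nat \<Rightarrow> dquat" where
  "JN3 m = of_nat (jacobsthal3 m) + real (jacobsthal3 (m + 1)) *\<^sub>R dq_i
     + real (jacobsthal3 (m + 2)) *\<^sub>R dq_j + real (jacobsthal3 (m + 3)) *\<^sub>R dq_k"

definition V3 :: "nat \<Rightarrow> real" where
  "V3 n = (if n mod 3 = 0 then 2 else if n mod 3 = 1 then -3 else 1)"

definition VN3 :: "nat \<Rightarrow> dquat" where
  "VN3 m = of_real (V3 m) + V3 (m + 1) *\<^sub>R dq_i + V3 (m + 2) *\<^sub>R dq_j + V3 (m + 3) *\<^sub>R dq_k"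

definition U3 :: "nat \<Rightarrow> real" where
  "U3 m = (V3 (m + 1) + 3 * V3 (m + 2)) / 7"

text \<open>The value at index \<open>0\<close> is deliberately left unspecified.\<close>

fun UN3 :: "nat \<Rightarrow> dquat" where
  "UN3 (Suc r) = (1 / 7) *\<^sub>R (2 *\<^sub>R VN3 r - VN3 (r + 1))"

definition dq_alpha :: dquat where
  "dq_alpha = 1 + 2 *\<^sub>R dq_i + 4 *\<^sub>R dq_j + 8 *\<^sub>R dq_k"

end

theory Submission
  imports Defs
begin

text \<open>
  The characteristic roots of the recurrence are \<open>2\<close> and the two primitive cube roots of unity,
  which gives the Binet-type formula \<open>7 JN m = 2 ^ (m + 1) \<alpha> - VN m\<close>, where \<open>\<alpha>\<close> is
  \<^const>\<open>dq_alpha\<close>. In the product difference the \<open>\<alpha>\<^sup>2\<close> terms cancel, the terms linear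
  in \<open>\<alpha>\<close> assemble to \<open>UN\<close>, and what is left is
  \<open>VN n * VN (m + 1) - VN (n + 1) * VN m\<close>. Since \<open>V (n + 2) = - V n - V (n + 1)\<close>, shifting both
  indices preserves determinants, so this depends only on \<open>n - m\<close>.
\<close>

lemma jacobsthal3_closed_form: "real (jacobsthal3 n) = (2 ^ (n + 1) - V3 n) / 7"
proof (induction n rule: jacobsthal3.induct)
  case (4 n)
  consider "n mod 3 = 0" | "n mod 3 = 1" | "n mod 3 = 2" by linarith
  then show ?case
    by cases (use "4.IH" in \<open>simp_all add: V3_def mod_Suc field_simps\<close>)
qed (simp_all add: V3_def)

lemma JN3_closed_form: "JN3 m = (1 / 7) *\<^sub>R (2 ^ (m + 1) *\<^sub>R dq_alpha - VN3 m)"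
proof -
  \<comment> \<open>Writing the \<open>of_nat\<close> coefficient through \<open>real\<close> lets
    the scalar closed form rewrite all four components.\<close>
  have "JN3 m = of_real (real (jacobsthal3 m)) + real (jacobsthal3 (m + 1)) *\<^sub>R dq_i
      + real (jacobsthal3 (m + 2)) *\<^sub>R dq_j + real (jacobsthal3 (m + 3)) *\<^sub>R dq_k"
    by (simp add: JN3_def)
  then show ?thesis
    unfolding jacobsthal3_closed_form
    by (simp add: VN3_def dq_alpha_def dq_i_def dq_j_def dq_k_def of_real_def dquat_eq_iff
        one_dquat_def plus_dquat_def minus_dquat_def scaleR_dquat_def field_simps power_add)
qed

lemma V3_Suc_Suc: "V3 (Suc (Suc n)) = - V3 n - V3 (Suc n)"
proof -
  have "n mod 3 < 3" by simp
  then show ?thesis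
    by (auto simp: V3_def mod_Suc)
qed

lemma V3_product_difference: "V3 (d + m) * V3 (Suc m) - V3 (Suc (d + m)) * V3 m = 7 * U3 d"
proof (induction m)
  case 0
  \<comment> \<open>With these initial values both sides equal
    \<open>- 3 * V3 d - 2 * V3 (Suc d)\<close>.\<close>
  have "V3 0 = 2" "V3 (Suc 0) = - 3"
    by (simp_all add: V3_def)
  then show ?case
    by (simp add: U3_def V3_Suc_Suc)
next
  case (Suc m)
  then show ?case
    by (simp add: V3_Suc_Suc algebra_simps)
qed

text \<open>Reducing all indices by \<open>V3_Suc_Suc\<close>, each component becomes a multiple of
  the same scalar determinant, with factors 1, -1, -1, 2.\<close>

lemma VN3_product_difference:
  "VN3 (d + m) * VN3 (m + 1) - VN3 (d + m + 1) * VN3 m =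
    (7 * U3 d) *\<^sub>R (1 - dq_i - dq_j + 2 *\<^sub>R dq_k)"
  unfolding V3_product_difference [of d m, symmetric]
  by (simp add: VN3_def numeral_3_eq_3 V3_Suc_Suc dq_i_def dq_j_def dq_k_def of_real_def
      dquat_eq_iff one_dquat_def plus_dquat_def minus_dquat_def scaleR_dquat_def
      times_dquat_def algebra_simps)

lemma JN3_product_difference:
  assumes "m \<le> n"
  shows "JN3 n * JN3 (m + 1) - JN3 (n + 1) * JN3 m =
    (1 / 7) *\<^sub>R
      (dq_alpha * (2 ^ (n + 1) *\<^sub>R UN3 (m + 1) - 2 ^ (m + 1) *\<^sub>R UN3 (n + 1))
       + U3 (n - m) *\<^sub>R (1 - dq_i - dq_j + 2 *\<^sub>R dq_k))"
proof -
  have "JN3 n * JN3 (m + 1) - JN3 (n + 1) * JN3 m =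
    (1 / 49) *\<^sub>R
      (dq_alpha * (2 ^ (n + 1) *\<^sub>R (2 *\<^sub>R VN3 m - VN3 (m + 1))
         - 2 ^ (m + 1) *\<^sub>R (2 *\<^sub>R VN3 n - VN3 (n + 1)))
       + (VN3 n * VN3 (m + 1) - VN3 (n + 1) * VN3 m))"
    unfolding JN3_closed_form
    by (simp add: dquat_eq_iff plus_dquat_def minus_dquat_def scaleR_dquat_def times_dquat_def
        field_simps)
  also have "\<dots> = (1 / 7) *\<^sub>R
      (dq_alpha * (2 ^ (n + 1) *\<^sub>R UN3 (m + 1) - 2 ^ (m + 1) *\<^sub>R UN3 (n + 1))
       + U3 (n - m) *\<^sub>R (1 - dq_i - dq_j + 2 *\<^sub>R dq_k))"
    \<comment> \<open>One factor 1/7 is absorbed by \<open>UN3\<close> in the terms with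
      \<open>dq_alpha\<close>, and cancels the 7 of \<open>7 * U3 (n - m)\<close> in the
      remainder.\<close>
    using VN3_product_difference [of "n - m" m] assms
    by (simp add: dquat_eq_iff plus_dquat_def minus_dquat_def scaleR_dquat_def times_dquat_def
        field_simps)
  finally show ?thesis .
qed

theorem theorem2p6:
  shows "(\<forall>n m :: nat. n \<ge> m \<longrightarrow>
      JN3 n * JN3 (m + 1) - JN3 (n + 1) * JN3 m =
        (1 / 7) *\<^sub>R
          (dq_alpha * (2 ^ (n + 1) *\<^sub>R UN3 (m + 1) - 2 ^ (m + 1) *\<^sub>R UN3 (n + 1))
           + U3 (n - m) *\<^sub>R (1 - dq_i - dq_j + 2 *\<^sub>R dq_k)))
    \<and> (\<forall>m :: nat.
      (JN3 (m + 1))\<^sup>2 - JN3 (m + 2) * JN3 m =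
        (1 / 7) *\<^sub>R
          (2 ^ (m + 1) *\<^sub>R (dq_alpha * (2 *\<^sub>R UN3 (m + 1) - UN3 (m + 2)))
           + (1 - dq_i - dq_j + 2 *\<^sub>R dq_k)))"
proof (intro conjI allI impI)
  fix m :: nat
  \<comment> \<open>The second identity is the case \<open>n = m + 1\<close> of the first:
    \<open>U3 (n - m)\<close> is \<open>U3 1\<close>, and \<open>2 ^ (n + 1)\<close> supplies the
    extra factor 2.\<close>
  have "U3 1 = 1"
    by (simp add: U3_def V3_def)
  then show "(JN3 (m + 1))\<^sup>2 - JN3 (m + 2) * JN3 m =
        (1 / 7) *\<^sub>R
          (2 ^ (m + 1) *\<^sub>R (dq_alpha * (2 *\<^sub>R UN3 (m + 1) - UN3 (m + 2)))
           + (1 - dq_i - dq_j + 2 *\<^sub>R dq_k))"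
    using JN3_product_difference [of m "m + 1"]
    by (simp add: power2_eq_square scaleR_right_diff_distrib right_diff_distrib mult.commute
        del: UN3.simps)
qed (rule JN3_product_difference)

end
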